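(* Let $W$ be a mesoscopic mechanical kernel (with parameter $d\in\mathbb{N}$). Let $\kappa_1=\frac12\langle(\varepsilon_a-\varepsilon_b)\,j(\varepsilon_a,\varepsilon_b)\rangle_1$ and $\kappa_f=\langle\nu(\varepsilon_a,\varepsilon_b)\rangle_1$, with $a\ne b$ two neighbouring sites. Then $\kappa_1=\kappa_f$ holds if and only if $$\int_0^1\int_0^1\tilde W(\alpha,\beta)\,d\beta\,d\alpha=\Big(d+\frac32\Big)\Big(d+\frac12\Big)\int_0^1\int_0^1\alpha(\alpha-\beta)\,\tilde W(\alpha,\beta)\,d\beta\,d\alpha,$$ where $\tilde W(\alpha,\beta)=W(\alpha,1-\alpha\,|\,\beta,1-\beta)\,(\alpha(1-\alpha))^{\frac d2-1}$ for $\alpha,\beta\in(0,1)$.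
   Context: A rate kernel $W(\varepsilon_a,\varepsilon_b\,|\,\varepsilon_a-\eta,\varepsilon_b+\eta)\ge 0$ (for $\varepsilon_a,\varepsilon_b>0$, $-\varepsilon_b<\eta<\varepsilon_a$) gives the rate at which an amount $\eta$ of energy is moved from a site with energy $\varepsilon_a$ to a neighbouring site with energy $\varepsilon_b$. $W$ is a mesoscopic mechanical kernel if (i) $W(c\varepsilon_a,c\varepsilon_b|c(\varepsilon_a-\eta),c(\varepsilon_b+\eta))=c^{-1/2}W(\varepsilon_a,\varepsilon_b|\varepsilon_a-\eta,\varepsilon_b+\eta)$ for all $c>0$; (ii) $W(\varepsilon_a,\varepsilon_b|\varepsilon_a-\eta,\varepsilon_b+\eta)=W(\varepsilon_b,\varepsilon_a|\varepsilon_b+\eta,\varepsilon_a-\eta)$; (iii) for some $d\in\mathbb{N}$, $(\varepsilon_a\varepsilon_b)^{\frac d2-1}W(\varepsilon_a,\varepsilon_b|\varepsilon_a-\eta,\varepsilon_b+\eta)=((\varepsilon_a-\eta)(\varepsilon_b+\eta))^{\frac d2-1}W(\varepsilon_a-\eta,\varepsilon_b+\eta|\varepsilon_a,\varepsilon_b)$. $\langle\cdot\rangle_1$ is expectation when the energies at distinct sites are i.i.d. with density $\varepsilon^{\frac d2-1}e^{-\varepsilon}/\Gamma(d/2)$ on $(0,\infty)$ (equilibrium at temperature $1$). $\nu(\varepsilon_a,\varepsilon_b)=\int_{-\varepsilon_b}^{\varepsilon_a}W(\varepsilon_a,\varepsilon_b|\varepsilon_a-\eta,\varepsilon_b+\eta)\,d\eta$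 and $j(\varepsilon_a,\varepsilon_b)=\int_{-\varepsilon_b}^{\varepsilon_a}\eta\,W(\varepsilon_a,\varepsilon_b|\varepsilon_a-\eta,\varepsilon_b+\eta)\,d\eta$. All integrals and expectations that appear are assumed to be absolutely convergent. *)

theory Defs
  imports "HOL-Probability.Probability"
begin

text \<open>
  \<open>W x y x' y'\<close> stands for \<open>W(x, y | x', y')\<close>. Only the values with \<open>x, y, x', y' > 0\<close> and
  \<open>x + y = x' + y'\<close> are meaningful, and every definition below refers to these values only.
\<close>

type_synonym kernel = "real \<Rightarrow> real \<Rightarrow> real \<Rightarrow> real \<Rightarrow> real"

definition exchange_domain :: "(real \<times> real \<times> real) set" where
  "exchange_domain = {(x, y, \<eta>). 0 < x \<and> 0 < y \<and> - y < \<eta> \<and> \<eta> < x}"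

text \<open>Joint measurability is the usual tacit requirement that makes iterated integrals meaningful.\<close>

definition rate_kernel :: "kernel \<Rightarrow> bool" where
  "rate_kernel W \<longleftrightarrow>
     (\<forall>(x, y, \<eta>) \<in> exchange_domain. 0 \<le> W x y (x - \<eta>) (y + \<eta>)) \<and>
     (\<lambda>(x, y, \<eta>). W x y (x - \<eta>) (y + \<eta>)) \<in> borel_measurable (restrict_space borel exchange_domain)"

definition mesoscopic_mechanical_kernel :: "nat \<Rightarrow> kernel \<Rightarrow> bool" where
  "mesoscopic_mechanical_kernel d W \<longleftrightarrow>
     rate_kernel W \<and>
     (\<forall>(x, y, \<eta>) \<in> exchange_domain. \<forall>c>0.
        W (c * x) (c * y) (c * (x - \<eta>)) (c * (y + \<eta>)) = c powr (- 1 / 2) * W x y (x - \<eta>) (y + \<eta>)) \<and>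
     (\<forall>(x, y, \<eta>) \<in> exchange_domain.
        W x y (x - \<eta>) (y + \<eta>) = W y x (y + \<eta>) (x - \<eta>)) \<and>
     (\<forall>(x, y, \<eta>) \<in> exchange_domain.
        (x * y) powr (real d / 2 - 1) * W x y (x - \<eta>) (y + \<eta>) =
        ((x - \<eta>) * (y + \<eta>)) powr (real d / 2 - 1) * W (x - \<eta>) (y + \<eta>) x y)"

definition total_rate :: "kernel \<Rightarrow> real \<Rightarrow> real \<Rightarrow> real" where
  "total_rate W x y = (LBINT \<eta>:{- y<..<x}. W x y (x - \<eta>) (y + \<eta>))"

definition mean_current :: "kernel \<Rightarrow> real \<Rightarrow> real \<Rightarrow> real" where
  "mean_current W x y = (LBINT \<eta>:{- y<..<x}. \<eta> * W x y (x - \<eta>) (y + \<eta>))"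

text \<open>
  The underlying space is \<open>(0, \<infinity>)\<close> itself rather than the whole line, so that the values of \<open>W\<close>
  at non-positive energies are irrelevant even for measurability.
\<close>

definition site_law :: "nat \<Rightarrow> real measure" where
  "site_law d = density (restrict_space lborel {0<..})
     (\<lambda>x. ennreal (x powr (real d / 2 - 1) * exp (- x) / Gamma (real d / 2)))"

text \<open>Equilibrium at temperature 1, on the energy configurations over a set of sites \<open>'s\<close>.\<close>

definition equilibrium :: "nat \<Rightarrow> ('s \<Rightarrow> real) measure" where
  "equilibrium d = (\<Pi>\<^sub>M s\<in>UNIV. site_law d)"

definition kappa_1 :: "nat \<Rightarrow> kernel \<Rightarrow> 's \<Rightarrow> 's \<Rightarrow> real" where
  "kappa_1 d W a b =
     1 / 2 * (LINT \<epsilon>|equilibrium d. (\<epsilon> a - \<epsilon> b) * mean_current W (\<epsilon> a) (\<epsilon> b))"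

definition kappa_f :: "nat \<Rightarrow> kernel \<Rightarrow> 's \<Rightarrow> 's \<Rightarrow> real" where
  "kappa_f d W a b = (LINT \<epsilon>|equilibrium d. total_rate W (\<epsilon> a) (\<epsilon> b))"

definition W_tilde :: "nat \<Rightarrow> kernel \<Rightarrow> real \<Rightarrow> real \<Rightarrow> real" where
  "W_tilde d W \<alpha> \<beta> =
     W \<alpha> (1 - \<alpha>) \<beta> (1 - \<beta>) * (\<alpha> * (1 - \<alpha>)) powr (real d / 2 - 1)"

end

theory Submission
  imports Defs
begin

text \<open>
  Put \<open>x = s \<alpha>\<close>, \<open>y = s (1 - \<alpha>)\<close> and \<open>\<eta> = s (\<alpha> - \<beta>)\<close>. By (i) the rate and the current are
  homogeneous of degrees \<open>1/2\<close> and \<open>3/2\<close> in the total energy \<open>s\<close>, so in both expectations the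
  integral over \<open>s\<close> splits off as a Gamma value: \<open>\<Gamma>(d + 1/2)\<close> for the frequency and
  \<open>\<Gamma>(d + 5/2) = (d + 3/2) (d + 1/2) \<Gamma>(d + 1/2)\<close> for the conductivity. What is left of the latter is
  \<open>1/2 \<integral>\<integral> (2\<alpha> - 1) (\<alpha> - \<beta>) W~\<close>, and \<open>\<integral>\<integral> (\<alpha> - \<beta>) W~\<close> vanishes, because \<open>W~\<close> is invariant under
  \<open>(\<alpha>, \<beta>) \<mapsto> (1 - \<alpha>, 1 - \<beta>)\<close> by (ii).
\<close>

section \<open>Gamma integrals and the equilibrium law of one site and of two sites\<close>

lemma has_bochner_integral_Gamma:
  assumes "0 < (z::real)"
  shows "has_bochner_integral lborel (\<lambda>t. indicator {0<..} t * (t powr (z - 1) * exp (- t))) (Gamma z)"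
proof -
  \<comment> \<open>The two half-lines differ only at \<open>t = 0\<close>, where both sides vanish
    because \<open>0 powr (z - 1) = 0\<close>.\<close>
  have eq: "indicator {0<..} t * (t powr (z - 1) * exp (- t)) = indicator {0..} t * t powr (z - 1) / exp t" for t
    by (auto simp: indicator_def exp_minus field_simps)
  have "(\<integral>\<^sup>+t. ennreal (indicator {0<..} t * (t powr (z - 1) * exp (- t))) \<partial>lborel) = ennreal (Gamma z)"
    unfolding eq by (rule Gamma_conv_nn_integral_real[OF assms, symmetric])
  then show ?thesis
    using Gamma_real_pos[OF assms] by (intro has_bochner_integral_nn_integral) auto
qed

lemma sets_site_law [measurable_cong]: "sets (site_law d) = sets (restrict_space borel {0<..})"
  by (simp add: site_law_def cong: sets_restrict_space_cong)

lemma space_site_law: "space (site_law d) = {0<..}"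
  by (simp add: site_law_def space_restrict_space)

lemma id_measurable_site_law: "(\<lambda>x. x) \<in> measurable (site_law d) borel"
  by (subst measurable_cong_sets[OF sets_site_law refl]) (rule measurable_restrict_space1, simp)

text \<open>The density of \<open>site_law\<close>, extended by zero to the whole line, so that
  integrals can be taken over \<open>lborel\<close> although the law itself lives on the open
  half-line.\<close>

definition site_density :: "nat \<Rightarrow> real \<Rightarrow> real" where
  "site_density d x = indicator {0<..} x * (x powr (real d / 2 - 1) * exp (- x) / Gamma (real d / 2))"

lemma site_density_measurable [measurable]: "site_density d \<in> borel_measurable borel"
  unfolding site_density_def by measurable

lemma site_density_nonneg: "d \<ge> 1 \<Longrightarrow> 0 \<le> site_density d x"
  using Gamma_real_pos[of "real d / 2"] by (auto simp: site_density_def indicator_def)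

lemma emeasure_site_law:
  assumes A: "A \<in> sets borel"
  shows "emeasure (site_law d) (A \<inter> {0<..}) = (\<integral>\<^sup>+x. ennreal (site_density d x) * indicator A x \<partial>lborel)"
proof -
  have "A \<inter> {0<..} \<in> sets (restrict_space lborel {0<..})"
    using A by (auto simp: sets_restrict_space)
  then have "emeasure (site_law d) (A \<inter> {0<..}) =
      (\<integral>\<^sup>+x. ennreal (x powr (real d / 2 - 1) * exp (- x) / Gamma (real d / 2)) * indicator (A \<inter> {0<..}) x
        \<partial>restrict_space lborel {0<..})"
    unfolding site_law_def
    by (intro emeasure_density measurable_restrict_space1) auto
  also have "\<dots> = (\<integral>\<^sup>+x. ennreal (site_density d x) * indicator A x \<partial>lborel)"
    by (subst nn_integral_restrict_space) (auto simp: site_density_def indicator_def intro!: nn_integral_cong)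
  finally show ?thesis .
qed

text \<open>Pushing the law forward along the inclusion of the half-line into the line puts it in
  the form that \<open>distributed\<close> asks for.\<close>

lemma distr_site_law: "distr (site_law d) lborel (\<lambda>x. x) = density lborel (\<lambda>x. ennreal (site_density d x))"
proof (rule measure_eqI)
  fix A assume "A \<in> sets (distr (site_law d) lborel (\<lambda>x. x))"
  then have A: "A \<in> sets borel" by simp
  then show "emeasure (distr (site_law d) lborel (\<lambda>x. x)) A = emeasure (density lborel (\<lambda>x. ennreal (site_density d x))) A"
    by (simp add: emeasure_distr id_measurable_site_law space_site_law emeasure_site_law emeasure_density)
qed simp

lemma prob_space_site_law:
  assumes "d \<ge> 1"
  shows "prob_space (site_law d)"
proof
  let ?z = "real d / 2"
  have z: "0 < ?z" using assms by simp
  have "has_bochner_integral lborel (site_density d) (Gamma ?z / Gamma ?z)"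
    using has_bochner_integral_divide_zero[OF has_bochner_integral_Gamma[OF z], of "Gamma ?z"]
    by (simp add: site_density_def[abs_def])
  then have "(\<integral>\<^sup>+x. ennreal (site_density d x) \<partial>lborel) = ennreal (Gamma ?z / Gamma ?z)"
    using site_density_nonneg[OF assms]
    by (auto simp: has_bochner_integral_iff nn_integral_eq_integral)
  with Gamma_real_pos[OF z] show "emeasure (site_law d) (space (site_law d)) = 1"
    using emeasure_site_law[of UNIV d] by (simp add: space_site_law)
qed

text \<open>Distinct coordinates of a product measure are independent, so their joint density is the
  product of the marginal ones. All expectations thereby become double Lebesgue integrals, whatever
  the set of sites.\<close>

lemma equilibrium_pair_distributed:
  fixes a b :: 's
  assumes d: "d \<ge> 1" and ab: "a \<noteq> b"
  shows "distributed (equilibrium d) (lborel \<Otimes>\<^sub>M lborel) (\<lambda>\<epsilon> :: 's \<Rightarrow> real. (\<epsilon> a, \<epsilon> b))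
    (\<lambda>(x, y). ennreal (site_density d x * site_density d y))"
proof -
  interpret S: prob_space "site_law d" by (rule prob_space_site_law[OF d])
  interpret P: product_prob_space "\<lambda>_ :: 's. site_law d" UNIV by unfold_locales
  interpret E: prob_space "equilibrium d :: ('s \<Rightarrow> real) measure"
    unfolding equilibrium_def by (rule prob_space_PiM) unfold_locales
  have comp: "(\<lambda>\<epsilon>. \<epsilon> s) \<in> measurable (equilibrium d) (site_law d)" for s :: 's
    unfolding equilibrium_def by measurable
  have distr: "distr (equilibrium d) (site_law d) (\<lambda>\<epsilon>. \<epsilon> s) = site_law d" for s :: 's
    unfolding equilibrium_def by (rule P.PiM_component) simp
  \<comment> \<open>This is the product criterion for independence: the joint law of all coordinates
    is the product of their marginals.\<close>
  have "distr (equilibrium d) (\<Pi>\<^sub>M s\<in>UNIV. site_law d) (\<lambda>\<epsilon>. \<lambda>s :: 's\<in>UNIV. \<epsilon> s) = equilibrium d"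
    by (simp add: restrict_UNIV equilibrium_def distr_id2)
  then have "E.indep_vars (\<lambda>_. site_law d) (\<lambda>s \<epsilon>. \<epsilon> s) UNIV"
    by (subst E.indep_vars_iff_distr_eq_PiM') (simp_all add: comp distr, simp add: equilibrium_def)
  then have "E.indep_vars (\<lambda>_. lborel) (\<lambda>s \<epsilon>. \<epsilon> s) UNIV"
    by (rule E.indep_vars_compose2) (simp add: id_measurable_site_law)
  \<comment> \<open>The subfamilies over the disjoint sets \<open>{a}\<close> and \<open>{b}\<close>
    are independent; evaluation then extracts their single coordinates.\<close>
  from E.indep_var_compose[OF E.indep_var_restrict[OF this, of "{a}" "{b}"],
      of "\<lambda>f. f a" lborel "\<lambda>f. f b" lborel]
  have indep: "E.indep_var lborel (\<lambda>\<epsilon>. \<epsilon> a) lborel (\<lambda>\<epsilon>. \<epsilon> b)"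
    using ab by (simp add: comp_def measurable_component_singleton)
  have dist: "distributed (equilibrium d) lborel (\<lambda>\<epsilon>. \<epsilon> s) (\<lambda>x. ennreal (site_density d x))" for s :: 's
  proof -
    have m: "(\<lambda>x. x) \<in> measurable (site_law d) lborel" using id_measurable_site_law by simp
    have "distr (equilibrium d) lborel (\<lambda>\<epsilon>. \<epsilon> s) = distr (distr (equilibrium d) (site_law d) (\<lambda>\<epsilon>. \<epsilon> s)) lborel (\<lambda>x. x)"
      by (subst distr_distr[OF m comp]) (simp add: comp_def)
    with measurable_comp[OF comp m] show ?thesis
      by (simp add: distributed_def distr distr_site_law comp_def)
  qed
  show ?thesis
    using E.distributed_joint_indep[OF _ _ dist[of a] dist[of b] indep] d
    by (simp add: lborel.sigma_finite_measure_axioms ennreal_mult'' site_density_nonneg)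
qed

section \<open>Separating the total energy from its distribution over two sites\<close>

text \<open>The shear \<open>(x, y)\<close> to \<open>(x, x + y)\<close> preserves Lebesgue measure,
  being a translation in the second variable for each fixed \<open>x\<close>; Fubini then makes the
  total \<open>s\<close> the outer variable.\<close>

lemma lborel_integral_antidiagonals:
  fixes F :: "real \<Rightarrow> real \<Rightarrow> real"
  assumes F: "integrable (lborel \<Otimes>\<^sub>M lborel) (\<lambda>(x, y). F x y)"
  shows "integral\<^sup>L (lborel \<Otimes>\<^sub>M lborel) (\<lambda>(x, y). F x y) = (LBINT s. LBINT x. F x (s - x))"
proof -
  have [measurable]: "(\<lambda>(x, y). F x y) \<in> borel_measurable (lborel \<Otimes>\<^sub>M lborel)"
    using F by (rule borel_measurable_integrable)
  have [measurable]: "(\<lambda>(x, s). F x (s - x)) \<in> borel_measurable (lborel \<Otimes>\<^sub>M lborel)"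
  proof -
    have "(\<lambda>(x, s). (x, s - x)) \<in> measurable (lborel \<Otimes>\<^sub>M lborel) (lborel \<Otimes>\<^sub>M (lborel :: real measure))"
      by measurable
    from measurable_compose[OF this \<open>(\<lambda>(x, y). F x y) \<in> _\<close>] show ?thesis
      by (simp add: split_beta')
  qed
  have shift: "(LBINT s. G (s - x)) = (LBINT y. G y)" for G :: "real \<Rightarrow> real" and x
    using lborel_integral_real_affine[of 1 G "- x"] by simp
  \<comment> \<open>Each slice in \<open>s\<close> is a translate of the slice of \<open>F\<close>
    at the same \<open>x\<close>, so integrability and the norm integrals carry over.\<close>
  have "integrable (lborel \<Otimes>\<^sub>M lborel) (\<lambda>(x, s). F x (s - x))"
  proof (rule lborel_pair.Fubini_integrable)
    have "integrable lborel (\<lambda>x. LBINT y. norm (F x y))"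
      using lborel_pair.integrable_fst[of "\<lambda>x y. norm (F x y)"] integrable_norm[OF F]
      by (simp add: split_beta')
    then show "integrable lborel (\<lambda>x. LBINT s. norm (case (x, s) of (x, s) \<Rightarrow> F x (s - x)))"
      by (simp add: shift[of "\<lambda>y. \<bar>F _ y\<bar>"])
    show "AE x in lborel. integrable lborel (\<lambda>s. case (x, s) of (x, s) \<Rightarrow> F x (s - x))"
      using lborel_pair.AE_integrable_fst[OF F]
    proof eventually_elim
      case (elim x)
      from lborel_integrable_real_affine[OF elim, of 1 "- x"] show ?case by simp
    qed
  qed simp
  from lborel_pair.Fubini_integral[OF this] show ?thesis
    unfolding shift lborel_pair.integral_fst[OF F] by simp
qed

text \<open>With \<open>x = s * \<alpha>\<close> and \<open>y = s * (1 - \<alpha>)\<close>, the two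
  densities contribute \<open>s powr (d - 2) * exp (- s)\<close>, homogeneity contributes
  \<open>s powr p\<close>, and the Jacobian one more factor \<open>s\<close>. The integral over
  \<open>s\<close> is therefore \<open>Gamma (d + p)\<close>, and only an integral over the energy
  fraction \<open>\<alpha>\<close> remains.\<close>

lemma equilibrium_homogeneous_expectation:
  fixes h :: "real \<Rightarrow> real \<Rightarrow> real" and a b :: 's
  assumes d: "d \<ge> 1" and ab: "a \<noteq> b" and p: "0 \<le> p"
    and meas: "(\<lambda>(x, y). h x y) \<in> borel_measurable (restrict_space borel ({0<..} \<times> {0<..}))"
    and hom: "\<And>x y c. 0 < x \<Longrightarrow> 0 < y \<Longrightarrow> 0 < c \<Longrightarrow> h (c * x) (c * y) = c powr p * h x y"
    and int: "integrable (equilibrium d) (\<lambda>\<epsilon> :: 's \<Rightarrow> real. h (\<epsilon> a) (\<epsilon> b))"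
  shows "(LINT \<epsilon> :: 's \<Rightarrow> real|equilibrium d. h (\<epsilon> a) (\<epsilon> b)) =
    Gamma (real d + p) / (Gamma (real d / 2))\<^sup>2 *
      (LBINT \<alpha>:{0<..<1}. h \<alpha> (1 - \<alpha>) * (\<alpha> * (1 - \<alpha>)) powr (real d / 2 - 1))"
proof -
  define q where "q = real d / 2 - 1"
  let ?G = "Gamma (real d / 2)"
  \<comment> \<open>Measurability of \<open>h\<close> is given on the open quadrant only; its
    extension by zero is measurable on the plane and agrees with \<open>h\<close> at all equilibrium
    configurations.\<close>
  define H where "H = (\<lambda>z. indicator ({0<..} \<times> {0<..}) z * (case z of (x, y) \<Rightarrow> h x y))"
  define F where "F x y = site_density d x * site_density d y * H (x, y)" for x y
  define A where "A = (LBINT \<alpha>:{0<..<1}. h \<alpha> (1 - \<alpha>) * (\<alpha> * (1 - \<alpha>)) powr q)"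
  have "open ({0<..} \<times> {0<..} :: (real \<times> real) set)" by (intro open_Times) auto
  then have H [measurable]: "H \<in> borel_measurable (lborel \<Otimes>\<^sub>M lborel)"
    using meas unfolding H_def lborel_prod
    by (subst (asm) borel_measurable_restrict_space_iff) (auto simp: measurable_lborel1)
  have H_eq: "H (\<epsilon> a, \<epsilon> b) = h (\<epsilon> a) (\<epsilon> b)" if "\<epsilon> \<in> space (equilibrium d)" for \<epsilon> :: "'s \<Rightarrow> real"
    using that by (auto simp: equilibrium_def space_PiM space_site_law H_def PiE_def Pi_def)
  have F_eq: "(\<lambda>z. (case z of (x, y) \<Rightarrow> site_density d x * site_density d y) * H z) = (\<lambda>(x, y). F x y)"
    by (auto simp: F_def)
  have dist: "distributed (equilibrium d) (lborel \<Otimes>\<^sub>M lborel) (\<lambda>\<epsilon> :: 's \<Rightarrow> real. (\<epsilon> a, \<epsilon> b))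
    (\<lambda>z. ennreal (case z of (x, y) \<Rightarrow> site_density d x * site_density d y))"
    using equilibrium_pair_distributed[OF d ab] by (simp add: split_beta')
  have nonneg: "0 \<le> (case z of (x, y) \<Rightarrow> site_density d x * site_density d y)" for z
    by (auto simp: site_density_nonneg[OF d] split: prod.split)
  have "integrable (equilibrium d) (\<lambda>\<epsilon> :: 's \<Rightarrow> real. H (\<epsilon> a, \<epsilon> b))"
    using int by (subst Bochner_Integration.integrable_cong[OF refl H_eq])
  then have F: "integrable (lborel \<Otimes>\<^sub>M lborel) (\<lambda>(x, y). F x y)"
    using distributed_integrable[OF dist H nonneg] by (simp add: F_eq)
  have F_scaled: "F (s * \<alpha>) (s - s * \<alpha>) = indicator {0<..<1} \<alpha> *
      (s powr (real d + p - 2) * exp (- s) / ?G\<^sup>2 * (h \<alpha> (1 - \<alpha>) * (\<alpha> * (1 - \<alpha>)) powr q))"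
    if s: "0 < s" for s \<alpha>
  proof (cases "0 < \<alpha> \<and> \<alpha> < 1")
    case False
    then have "\<not> (0 < s * \<alpha> \<and> 0 < s - s * \<alpha>)"
      using s by (auto simp: zero_less_mult_iff mult_less_cancel_left2)
    with False show ?thesis by (auto simp: F_def H_def)
  next
    case True
    have eq: "s - s * \<alpha> = s * (1 - \<alpha>)" by (simp add: algebra_simps)
    have pos: "0 < s * \<alpha>" "0 < s * (1 - \<alpha>)" using s True by auto
    have "s powr (real d + p - 2) = s powr q * s powr q * s powr p"
      unfolding q_def powr_add[symmetric] by (simp add: algebra_simps)
    moreover have "exp (- s) = exp (- (s * \<alpha>)) * exp (- (s * (1 - \<alpha>)))"
      unfolding exp_add[symmetric] by (simp add: algebra_simps)
    ultimately show ?thesis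
      unfolding eq using pos True s hom[of \<alpha> "1 - \<alpha>" s]
      by (simp add: F_def H_def site_density_def powr_mult power2_eq_square flip: q_def)
  qed
  \<comment> \<open>The exponent grows from \<open>d + p - 2\<close> to \<open>d + p - 1\<close>
    through the Jacobian of \<open>x = s * \<alpha>\<close>.\<close>
  have inner: "(LBINT x. F x (s - x)) =
      indicator {0<..} s * (s powr (real d + p - 1) * exp (- s)) * (A / ?G\<^sup>2)" for s
  proof (cases "0 < s")
    case False
    then have "F x (s - x) = 0" for x by (auto simp: F_def H_def)
    with False show ?thesis by simp
  next
    case True
    have "(LBINT x. F x (s - x)) = s * (LBINT \<alpha>. F (s * \<alpha>) (s - s * \<alpha>))"
      using lborel_integral_real_affine[of s "\<lambda>x. F x (s - x)" 0] True by simp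
    also have "(LBINT \<alpha>. F (s * \<alpha>) (s - s * \<alpha>)) = s powr (real d + p - 2) * exp (- s) / ?G\<^sup>2 * A"
      unfolding F_scaled[OF True] A_def set_lebesgue_integral_def
      by (subst integral_mult_right_zero[symmetric]) (simp add: ac_simps)
    also have "s * (s powr (real d + p - 2) * exp (- s) / ?G\<^sup>2 * A) =
        s powr (real d + p - 1) * exp (- s) * (A / ?G\<^sup>2)"
      using True powr_add[of s 1 "real d + p - 2"] by (simp add: algebra_simps)
    finally show ?thesis using True by simp
  qed
  have "(LINT \<epsilon> :: 's \<Rightarrow> real|equilibrium d. h (\<epsilon> a) (\<epsilon> b)) = (LINT \<epsilon> :: 's \<Rightarrow> real|equilibrium d. H (\<epsilon> a, \<epsilon> b))"
    by (rule Bochner_Integration.integral_cong) (auto simp: H_eq)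
  also have "\<dots> = integral\<^sup>L (lborel \<Otimes>\<^sub>M lborel) (\<lambda>(x, y). F x y)"
    using distributed_integral[OF dist H nonneg] by (simp add: F_eq)
  also have "\<dots> = (LBINT s. LBINT x. F x (s - x))"
    by (rule lborel_integral_antidiagonals[OF F])
  also have "\<dots> = Gamma (real d + p) * (A / ?G\<^sup>2)"
    unfolding inner using has_bochner_integral_Gamma[of "real d + p"] d p
    by (simp add: has_bochner_integral_iff)
  finally show ?thesis by (simp add: A_def q_def)
qed

section \<open>Moments of the kernel in the exchanged energy\<close>

text \<open>The domain of integration moves with \<open>(x, y)\<close>. Extending \<open>W\<close>
  by zero off the open set \<open>exchange_domain\<close> gives a jointly measurable integrand over
  a fixed line. The cases \<open>k = 0\<close> and \<open>k = 1\<close> are the rate and the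
  current.\<close>

lemma rate_kernel_moment_measurable:
  assumes "rate_kernel W"
  shows "(\<lambda>(x, y). LBINT \<eta>:{- y<..<x}. \<eta> ^ k * W x y (x - \<eta>) (y + \<eta>))
    \<in> borel_measurable (restrict_space borel ({0<..} \<times> {0<..}))"
proof -
  define G where "G z = indicator exchange_domain z * (case z of (x, y, \<eta>) \<Rightarrow> W x y (x - \<eta>) (y + \<eta>))" for z
  have "exchange_domain = {z. 0 < fst z \<and> 0 < fst (snd z) \<and> - fst (snd z) < snd (snd z) \<and> snd (snd z) < fst z}"
    by (auto simp: exchange_domain_def)
  also have "open \<dots>"
    by (intro open_Collect_conj open_Collect_less continuous_intros)
  finally have "G \<in> borel_measurable borel"
    using assms unfolding rate_kernel_def G_def
    by (subst (asm) borel_measurable_restrict_space_iff) auto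
  then have [measurable]: "G \<in> borel_measurable (borel \<Otimes>\<^sub>M borel \<Otimes>\<^sub>M borel)"
    by (simp add: borel_prod)
  have "(\<lambda>z. LBINT \<eta>. \<eta> ^ k * G (fst z, snd z, \<eta>)) \<in> borel_measurable (borel \<Otimes>\<^sub>M borel)"
    by measurable
  then have "(\<lambda>z. LBINT \<eta>. \<eta> ^ k * G (fst z, snd z, \<eta>))
      \<in> borel_measurable (restrict_space borel ({0<..} \<times> {0<..}))"
    by (intro measurable_restrict_space1) (simp add: borel_prod)
  then show ?thesis
    by (rule measurable_cong[THEN iffD1, rotated])
      (auto simp: space_restrict_space set_lebesgue_integral_def G_def exchange_domain_def indicator_def
        intro!: Bochner_Integration.integral_cong)
qed

text \<open>Substituting \<open>c * \<eta>\<close> for \<open>\<eta>\<close> yields one factor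
  \<open>c\<close> from the Jacobian and \<open>c ^ k\<close> from the power; the scaling law (i)
  supplies \<open>c powr (- 1 / 2)\<close>.\<close>

lemma mesoscopic_moment_homogeneous:
  assumes W: "mesoscopic_mechanical_kernel d W" and pos: "0 < x" "0 < y" "0 < c"
  shows "(LBINT \<eta>:{- (c * y)<..<c * x}. \<eta> ^ k * W (c * x) (c * y) (c * x - \<eta>) (c * y + \<eta>)) =
    c powr (real k + 1 / 2) * (LBINT \<eta>:{- y<..<x}. \<eta> ^ k * W x y (x - \<eta>) (y + \<eta>))"
proof -
  have scale: "W (c * x) (c * y) (c * x - c * \<eta>) (c * y + c * \<eta>) = c powr (- 1 / 2) * W x y (x - \<eta>) (y + \<eta>)"
    if "- y < \<eta>" "\<eta> < x" for \<eta>
  proof -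
    have "(x, y, \<eta>) \<in> exchange_domain" using pos that by (simp add: exchange_domain_def)
    with W pos have "W (c * x) (c * y) (c * (x - \<eta>)) (c * (y + \<eta>)) = c powr (- 1 / 2) * W x y (x - \<eta>) (y + \<eta>)"
      unfolding mesoscopic_mechanical_kernel_def by fast
    then show ?thesis by (simp add: algebra_simps)
  qed
  have dom: "- (c * y) < c * \<eta> \<longleftrightarrow> - y < \<eta>" for \<eta>
    using pos mult_less_cancel_left_pos[of c "- y" \<eta>] by simp
  have "c powr (real k + 1 / 2) = c powr (1 + real k + (- 1 / 2))"
    by (rule arg_cong[where f = "(powr) c"]) simp
  also have "\<dots> = c * c ^ k * c powr (- 1 / 2)"
    unfolding powr_add using pos by (simp add: powr_realpow)
  finally have c: "c powr (real k + 1 / 2) = c * c ^ k * c powr (- 1 / 2)" .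
  have "(LBINT \<eta>:{- (c * y)<..<c * x}. \<eta> ^ k * W (c * x) (c * y) (c * x - \<eta>) (c * y + \<eta>)) =
      c * (LBINT \<eta>. indicator {- (c * y)<..<c * x} (c * \<eta>) *
        ((c * \<eta>) ^ k * W (c * x) (c * y) (c * x - c * \<eta>) (c * y + c * \<eta>)))"
    unfolding set_lebesgue_integral_def
    using pos by (subst lborel_integral_real_affine[of c _ 0]) auto
  also have "\<dots> = c * (LBINT \<eta>. c ^ k * c powr (- 1 / 2) *
      (indicator {- y<..<x} \<eta> * (\<eta> ^ k * W x y (x - \<eta>) (y + \<eta>))))"
    using pos by (intro arg_cong[where f = "(*) c"] Bochner_Integration.integral_cong)
      (auto simp: indicator_def scale dom power_mult_distrib)
  finally show ?thesis
    by (simp add: set_lebesgue_integral_def c)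
qed

text \<open>The substitution \<open>\<beta> = \<alpha> - \<eta>\<close> replaces the exchanged
  energy by the energy left at the first site; its Jacobian has modulus 1, and the weight depends on
  \<open>\<alpha>\<close> alone.\<close>

lemma moment_on_simplex:
  assumes "0 < \<alpha>" "\<alpha> < 1"
  shows "(LBINT \<eta>:{- (1 - \<alpha>)<..<\<alpha>}. \<eta> ^ k * W \<alpha> (1 - \<alpha>) (\<alpha> - \<eta>) (1 - \<alpha> + \<eta>)) *
      (\<alpha> * (1 - \<alpha>)) powr (real d / 2 - 1) =
    (LBINT \<beta>:{0<..<1}. (\<alpha> - \<beta>) ^ k * W_tilde d W \<alpha> \<beta>)"
proof -
  let ?w = "(\<alpha> * (1 - \<alpha>)) powr (real d / 2 - 1)"
  have "(LBINT \<eta>:{- (1 - \<alpha>)<..<\<alpha>}. \<eta> ^ k * W \<alpha> (1 - \<alpha>) (\<alpha> - \<eta>) (1 - \<alpha> + \<eta>)) * ?w =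
      (LBINT \<beta>. indicator {- (1 - \<alpha>)<..<\<alpha>} (\<alpha> - \<beta>) *
        ((\<alpha> - \<beta>) ^ k * W \<alpha> (1 - \<alpha>) (\<alpha> - (\<alpha> - \<beta>)) (1 - \<alpha> + (\<alpha> - \<beta>)))) * ?w"
    unfolding set_lebesgue_integral_def
    by (subst lborel_integral_real_affine[of "- 1" _ \<alpha>]) auto
  also have "\<dots> = (LBINT \<beta>. indicator {0<..<1} \<beta> * ((\<alpha> - \<beta>) ^ k * W_tilde d W \<alpha> \<beta>))"
    unfolding integral_mult_left_zero[symmetric]
    by (intro Bochner_Integration.integral_cong) (auto simp: W_tilde_def indicator_def)
  finally show ?thesis by (simp add: set_lebesgue_integral_def)
qed

section \<open>Comparison of the conductivity with the exchange frequency\<close>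

theorem proposition4p2:
  fixes W :: kernel and d :: nat and a b :: 's
  assumes "d \<ge> 1"
    and "mesoscopic_mechanical_kernel d W"
    and "a \<noteq> b"
    and "\<And>x y. 0 < x \<Longrightarrow> 0 < y \<Longrightarrow>
           set_integrable lborel {- y<..<x} (\<lambda>\<eta>. W x y (x - \<eta>) (y + \<eta>))"
    and "\<And>x y. 0 < x \<Longrightarrow> 0 < y \<Longrightarrow>
           set_integrable lborel {- y<..<x} (\<lambda>\<eta>. \<eta> * W x y (x - \<eta>) (y + \<eta>))"
    and "integrable (equilibrium d)
           (\<lambda>\<epsilon> :: 's \<Rightarrow> real. (\<epsilon> a - \<epsilon> b) * mean_current W (\<epsilon> a) (\<epsilon> b))"
    and "integrable (equilibrium d)
           (\<lambda>\<epsilon> :: 's \<Rightarrow> real. total_rate W (\<epsilon> a) (\<epsilon> b))"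
    and "\<And>\<alpha>. \<alpha> \<in> {0<..<1} \<Longrightarrow>
           set_integrable lborel {0<..<1} (\<lambda>\<beta>. W_tilde d W \<alpha> \<beta>)"
    and "set_integrable lborel {0<..<1}
           (\<lambda>\<alpha>. LBINT \<beta>:{0<..<1}. W_tilde d W \<alpha> \<beta>)"
    and "\<And>\<alpha>. \<alpha> \<in> {0<..<1} \<Longrightarrow>
           set_integrable lborel {0<..<1} (\<lambda>\<beta>. \<alpha> * (\<alpha> - \<beta>) * W_tilde d W \<alpha> \<beta>)"
    and "set_integrable lborel {0<..<1}
           (\<lambda>\<alpha>. LBINT \<beta>:{0<..<1}. \<alpha> * (\<alpha> - \<beta>) * W_tilde d W \<alpha> \<beta>)"
  shows "kappa_1 d W a b = kappa_f d W a b \<longleftrightarrow>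
     (LBINT \<alpha>:{0<..<1}. LBINT \<beta>:{0<..<1}. W_tilde d W \<alpha> \<beta>) =
     (real d + 3 / 2) * (real d + 1 / 2) *
       (LBINT \<alpha>:{0<..<1}. LBINT \<beta>:{0<..<1}. \<alpha> * (\<alpha> - \<beta>) * W_tilde d W \<alpha> \<beta>)"
proof -
  let ?I = "{0<..<1} :: real set"
  let ?G = "Gamma (real d / 2)"
  let ?C = "Gamma (real d + 1 / 2) / ?G\<^sup>2"
  define T where "T = W_tilde d W"
  define J where "J \<alpha> = (LBINT \<beta>:?I. (\<alpha> - \<beta>) * T \<alpha> \<beta>)" for \<alpha>
  let ?A = "LBINT \<alpha>:?I. LBINT \<beta>:?I. T \<alpha> \<beta>"
  let ?B = "LBINT \<alpha>:?I. LBINT \<beta>:?I. \<alpha> * (\<alpha> - \<beta>) * T \<alpha> \<beta>"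
  note W = assms(2)
  have rate: "rate_kernel W" using W by (simp add: mesoscopic_mechanical_kernel_def)
  have meas: "(\<lambda>(x, y). total_rate W x y) \<in> borel_measurable (restrict_space borel ({0<..} \<times> {0<..}))"
    "(\<lambda>(x, y). mean_current W x y) \<in> borel_measurable (restrict_space borel ({0<..} \<times> {0<..}))"
    using rate_kernel_moment_measurable[OF rate, of 0] rate_kernel_moment_measurable[OF rate, of 1]
    by (simp_all add: total_rate_def mean_current_def)
  have hom: "total_rate W (c * x) (c * y) = c powr (1 / 2) * total_rate W x y"
    "mean_current W (c * x) (c * y) = c powr (3 / 2) * mean_current W x y"
    if "0 < x" "0 < y" "0 < c" for x y c
    using mesoscopic_moment_homogeneous[OF W that, of 0] mesoscopic_moment_homogeneous[OF W that, of 1]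
    by (simp_all add: total_rate_def mean_current_def)
  have slice: "total_rate W \<alpha> (1 - \<alpha>) * (\<alpha> * (1 - \<alpha>)) powr (real d / 2 - 1) = (LBINT \<beta>:?I. T \<alpha> \<beta>)"
    "mean_current W \<alpha> (1 - \<alpha>) * (\<alpha> * (1 - \<alpha>)) powr (real d / 2 - 1) = J \<alpha>"
    if "\<alpha> \<in> ?I" for \<alpha>
    using moment_on_simplex[of \<alpha> 0 W d] moment_on_simplex[of \<alpha> 1 W d] that
    by (simp_all add: total_rate_def mean_current_def T_def J_def)

  have "kappa_f d W a b = ?C *
      (LBINT \<alpha>:?I. total_rate W \<alpha> (1 - \<alpha>) * (\<alpha> * (1 - \<alpha>)) powr (real d / 2 - 1))"
    unfolding kappa_f_def
    by (rule equilibrium_homogeneous_expectation[OF assms(1,3) _ meas(1) _ assms(7)]) (simp_all add: hom)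
  also have "(LBINT \<alpha>:?I. total_rate W \<alpha> (1 - \<alpha>) * (\<alpha> * (1 - \<alpha>)) powr (real d / 2 - 1)) = ?A"
    by (intro set_lebesgue_integral_cong) (auto simp: slice)
  finally have kf: "kappa_f d W a b = ?C * ?A" .

  have "kappa_1 d W a b = 1 / 2 * (Gamma (real d + 5 / 2) / ?G\<^sup>2 *
      (LBINT \<alpha>:?I. (\<alpha> - (1 - \<alpha>)) * mean_current W \<alpha> (1 - \<alpha>) * (\<alpha> * (1 - \<alpha>)) powr (real d / 2 - 1)))"
    unfolding kappa_1_def
  proof (rule arg_cong[where f = "(*) (1 / 2)"],
      rule equilibrium_homogeneous_expectation[OF assms(1,3) _ _ _ assms(6)])
    have "(\<lambda>z. (fst z - snd z) * (case z of (x, y) \<Rightarrow> mean_current W x y))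
        \<in> borel_measurable (restrict_space borel ({0<..} \<times> {0<..}))"
      by (intro borel_measurable_times meas(2) measurable_restrict_space1 borel_measurable_continuous_onI
          continuous_intros)
    then show "(\<lambda>(x, y). (x - y) * mean_current W x y)
        \<in> borel_measurable (restrict_space borel ({0<..} \<times> {0<..}))"
      by (simp add: split_beta')
    \<comment> \<open>The degree \<open>5 / 2\<close> is 1 from the energy difference plus
      \<open>3 / 2\<close> from the current.\<close>
    show "(c * x - c * y) * mean_current W (c * x) (c * y) = c powr (5 / 2) * ((x - y) * mean_current W x y)"
      if "0 < x" "0 < y" "0 < c" for x y c
      using powr_add[of c 1 "3 / 2"] that by (simp add: hom algebra_simps)
  qed simp
  also have "(LBINT \<alpha>:?I. (\<alpha> - (1 - \<alpha>)) * mean_current W \<alpha> (1 - \<alpha>) * (\<alpha> * (1 - \<alpha>)) powr (real d / 2 - 1)) =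
      (LBINT \<alpha>:?I. 2 * (\<alpha> * J \<alpha>) - J \<alpha>)"
    by (intro set_lebesgue_integral_cong) (simp_all add: mult.assoc slice(2), simp add: algebra_simps)
  \<comment> \<open>The term \<open>- J \<alpha>\<close> drops out by antisymmetry about
    \<open>1 / 2\<close>; splitting it off also requires \<open>J\<close> to be integrable, which is
    derived by domination.\<close>
  also have "\<dots> = 2 * (LBINT \<alpha>:?I. \<alpha> * J \<alpha>)"
  proof -
    have T_nonneg: "0 \<le> T \<alpha> \<beta>" if "\<alpha> \<in> ?I" "\<beta> \<in> ?I" for \<alpha> \<beta>
    proof -
      \<comment> \<open>Exchanging \<open>\<alpha> - \<beta>\<close> leaves the energies
        \<open>\<beta>\<close> and \<open>1 - \<beta>\<close>, the arguments occurring in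
        \<open>W_tilde\<close>.\<close>
      have "(\<alpha>, 1 - \<alpha>, \<alpha> - \<beta>) \<in> exchange_domain" using that by (auto simp: exchange_domain_def)
      with rate show ?thesis unfolding rate_kernel_def T_def W_tilde_def by fastforce
    qed
    have T_reflect: "T (1 - \<alpha>) (1 - \<beta>) = T \<alpha> \<beta>" if "\<alpha> \<in> ?I" "\<beta> \<in> ?I" for \<alpha> \<beta>
    proof -
      have "(\<alpha>, 1 - \<alpha>, \<alpha> - \<beta>) \<in> exchange_domain" using that by (auto simp: exchange_domain_def)
      with W have "W \<alpha> (1 - \<alpha>) \<beta> (1 - \<beta>) = W (1 - \<alpha>) \<alpha> (1 - \<beta>) \<beta>"
        unfolding mesoscopic_mechanical_kernel_def by fastforce
      then show ?thesis by (simp add: T_def W_tilde_def mult.commute)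
    qed
    have reflect: "(LBINT x:?I. f (1 - x)) = (LBINT x:?I. f x)" for f :: "real \<Rightarrow> real"
      unfolding set_lebesgue_integral_def
      by (subst (2) lborel_integral_real_affine[of "- 1" _ 1])
        (auto simp: indicator_def intro!: Bochner_Integration.integral_cong)
    have J_reflect: "J (1 - \<alpha>) = - J \<alpha>" if "\<alpha> \<in> ?I" for \<alpha>
    proof -
      have "J (1 - \<alpha>) = (LBINT \<beta>:?I. (1 - \<alpha> - (1 - \<beta>)) * T (1 - \<alpha>) (1 - \<beta>))"
        unfolding J_def by (rule reflect[symmetric])
      also have "\<dots> = (LBINT \<beta>:?I. - ((\<alpha> - \<beta>) * T \<alpha> \<beta>))"
        using that by (intro set_lebesgue_integral_cong) (auto simp: T_reflect algebra_simps)
      finally show ?thesis by (simp add: J_def set_integral_uminus set_lebesgue_integral_def)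
    qed
    \<comment> \<open>Reflection turns the integral into its own negative.\<close>
    have "(LBINT \<alpha>:?I. J \<alpha>) = (LBINT \<alpha>:?I. J (1 - \<alpha>))" by (rule reflect[symmetric])
    also have "\<dots> = (LBINT \<alpha>:?I. - J \<alpha>)"
      by (intro set_lebesgue_integral_cong) (auto simp: J_reflect)
    finally have J_zero: "(LBINT \<alpha>:?I. J \<alpha>) = 0"
      by (simp add: set_lebesgue_integral_def)
    have alpha_J: "set_integrable lborel ?I (\<lambda>\<alpha>. \<alpha> * J \<alpha>)"
      using assms(11) by (simp add: J_def T_def mult.assoc set_lebesgue_integral_def mult.left_commute)
    \<comment> \<open>Since \<open>\<bar>\<alpha> - \<beta>\<bar> \<le> 1\<close> on the unit square
      and \<open>T\<close> is nonnegative there, the slice integral of \<open>T\<close> dominates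
      \<open>J\<close>.\<close>
    have J_bound: "\<bar>J \<alpha>\<bar> \<le> (LBINT \<beta>:?I. T \<alpha> \<beta>)" if \<alpha>: "\<alpha> \<in> ?I" for \<alpha>
    proof -
      have "set_integrable lborel ?I (\<lambda>\<beta>. T \<alpha> \<beta>)" using assms(8)[OF \<alpha>] by (simp add: T_def)
      moreover have "\<bar>(\<alpha> - \<beta>) * T \<alpha> \<beta>\<bar> \<le> T \<alpha> \<beta>" if "\<beta> \<in> ?I" for \<beta>
        using T_nonneg[OF \<alpha> that] \<alpha> that mult_right_mono[of "\<bar>\<alpha> - \<beta>\<bar>" 1 "T \<alpha> \<beta>"] by (auto simp: abs_mult)
      ultimately show ?thesis
        unfolding J_def set_lebesgue_integral_def set_integrable_def real_norm_def[symmetric]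
        by (intro order_trans[OF integral_norm_bound integral_mono'])
          (use T_nonneg[OF \<alpha>] in \<open>auto simp: indicator_def\<close>)
    qed
    have J: "set_integrable lborel ?I J"
      unfolding set_integrable_def
    proof (rule Bochner_Integration.integrable_bound)
      show "integrable lborel (\<lambda>\<alpha>. indicator ?I \<alpha> *\<^sub>R (LBINT \<beta>:?I. T \<alpha> \<beta>))"
        using assms(9) by (simp add: T_def set_integrable_def)
      \<comment> \<open>Measurability of \<open>J\<close> is recovered from that of
        \<open>\<alpha> * J \<alpha>\<close> by dividing by \<open>\<alpha>\<close>, which is
        nonzero on the interval.\<close>
      have "(\<lambda>\<alpha>. (1 / \<alpha>) * (indicator ?I \<alpha> *\<^sub>R (\<alpha> * J \<alpha>))) \<in> borel_measurable lborel"
        using borel_measurable_integrable[OF alpha_J[unfolded set_integrable_def]] by measurable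
      then show "(\<lambda>\<alpha>. indicator ?I \<alpha> *\<^sub>R J \<alpha>) \<in> borel_measurable lborel"
        by (rule measurable_cong[THEN iffD1, rotated]) (auto simp: indicator_def)
      show "AE \<alpha> in lborel. norm (indicator ?I \<alpha> *\<^sub>R J \<alpha>) \<le> norm (indicator ?I \<alpha> *\<^sub>R (LBINT \<beta>:?I. T \<alpha> \<beta>))"
        using J_bound by (intro AE_I2) (force simp: indicator_def)
    qed
    show ?thesis
      using J alpha_J by (simp add: set_integral_diff J_zero)
  qed
  also have "(LBINT \<alpha>:?I. \<alpha> * J \<alpha>) = ?B"
    by (simp add: J_def mult.assoc)
  \<comment> \<open>Two applications of the recursion \<open>Gamma (z + 1) = z * Gamma z\<close>
    produce the constant of the criterion.\<close>
  also have "Gamma (real d + 5 / 2) = (real d + 3 / 2) * (real d + 1 / 2) * Gamma (real d + 1 / 2)"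
  proof -
    have "real d + 3 / 2 \<notin> \<int>\<^sub>\<le>\<^sub>0" "real d + 1 / 2 \<notin> \<int>\<^sub>\<le>\<^sub>0"
      by (auto simp: nonpos_Ints_def)
    from this[THEN Gamma_plus1] show ?thesis by (simp add: add.assoc)
  qed
  finally have k1: "kappa_1 d W a b = ?C * ((real d + 3 / 2) * (real d + 1 / 2) * ?B)"
    by simp
  \<comment> \<open>Both coefficients carry the factor \<open>?C\<close>, so cancelling it leaves
    exactly the stated equation.\<close>
  have "?C > 0"
    using assms(1) by (intro divide_pos_pos zero_less_power Gamma_real_pos) auto
  then show ?thesis
    unfolding k1 kf T_def by (auto simp del: divide_eq_0_iff)
qed

end
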